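(* Let $M \in \mathbb{R}^{n\times n}$ be a stochastic matrix and let $Q \in \mathbb{R}^{n\times n}$ be invertible, such that $J = Q^{-1} M Q$ is the Jordan normal form of $M$. Then $$\lim_{N\to\infty} S_N[M] \;=\; \lim_{\varepsilon \to 0} C_\varepsilon[M] \;=\; P_{\mathrm{fix}(M)},$$ where $P_{\mathrm{fix}(M)}$ is the projection onto $\mathrm{fix}(M) = \{v\in\mathbb{R}^n \mid v^T M = v^T\}$ given by $$P_{\mathrm{fix}(M)} = Q^{-1}\, P_{\mathrm{fix}(J)}\, Q,$$ and $P_{\mathrm{fix}(J)}$ is an orthogonal projection.
   Context: A matrix $M\in\mathbb{R}^{n\times n}$ is stochastic (row-stochastic) if its entries are non-negative and each row sums to $1$. For a square matrix $O$ define the ergodic mean $S_N[O] = \frac{1}{N}\sum_{k=0}^{N-1} O^k$ for $N\in\mathbb{N}$, and the geometric mean $C_\varepsilon[O] = \varepsilon\sum_{k=0}^{\infty}(1-\varepsilon)^k O^k$ for $\varepsilon\in(0,1]$. The convention is that matrices act by right-multiplication on row vectors, $v^T\mapsto v^T M$. A projection is a linear map $P$ with $P^2=P$; it is called orthogonal if its kernel and image are orthogonal to each other. $P_{\mathrm{fix}(J)}$ denotes the projection onto $\mathrm{fix}(J)$, the set of vectors $v$ with $v^T J = v^T$, defined for $J$ in the same way as $\mathrm{fix}(M)$ for $M$.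
   Formalization: With J = Q^{-1}MQ as matrices, the matrix product Q^{-1}P_fix(J)Q is not P_fix(M) in general; the formula is proved as a composition of maps on row vectors, i.e. as matrices P_fix(M) = Q P_fix(J) Q^{-1}. Q and J may also be complex. *)

theory Defs
  imports Complex_Main "Jordan_Normal_Form.Jordan_Normal_Form"
begin

definition stochastic_mat :: "nat \<Rightarrow> real mat \<Rightarrow> bool" where
  "stochastic_mat n M \<longleftrightarrow> M \<in> carrier_mat n n \<and>
     (\<forall>i<n. \<forall>j<n. 0 \<le> M $$ (i, j)) \<and> (\<forall>i<n. (\<Sum>j<n. M $$ (i, j)) = 1)"

(* Type mat carries no topology; for a fixed size, the topology of R^(n x n) is that of
   entrywise convergence. *)
definition mat_tendsto :: "nat \<Rightarrow> ('b \<Rightarrow> real mat) \<Rightarrow> real mat \<Rightarrow> 'b filter \<Rightarrow> bool" where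
  "mat_tendsto n F L net \<longleftrightarrow> L \<in> carrier_mat n n \<and> (\<forall>\<^sub>F x in net. F x \<in> carrier_mat n n) \<and>
     (\<forall>i<n. \<forall>j<n. ((\<lambda>x. F x $$ (i, j)) \<longlongrightarrow> L $$ (i, j)) net)"

(* The sums of matrices in the two means are taken entry by entry, since type mat is not an
   instance of comm_monoid_add. *)
definition ergodic_mean :: "real mat \<Rightarrow> nat \<Rightarrow> real mat" where
  "ergodic_mean A N = mat (dim_row A) (dim_row A)
     (\<lambda>(i, j). 1 / real N * (\<Sum>k<N. (A ^\<^sub>m k) $$ (i, j)))"

definition geometric_mean :: "real mat \<Rightarrow> real \<Rightarrow> real mat" where
  "geometric_mean A \<epsilon> = mat (dim_row A) (dim_row A)
     (\<lambda>(i, j). \<epsilon> * (\<Sum>k. (1 - \<epsilon>) ^ k * (A ^\<^sub>m k) $$ (i, j)))"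

(* The linear map on row vectors, v^T to v^T A, with row vectors represented by type vec.
   As maps, row_map (A * B) = row_map B o row_map A: products of matrices are reversed. *)
definition row_map :: "'a::comm_semiring_0 mat \<Rightarrow> 'a vec \<Rightarrow> 'a vec" where
  "row_map A v = transpose_mat A *\<^sub>v v"

definition fix_space :: "nat \<Rightarrow> 'a::comm_semiring_0 mat \<Rightarrow> 'a vec set" where
  "fix_space n A = {v \<in> carrier_vec n. row_map A v = v}"

(* Projections are represented by their matrices with respect to row_map. *)
definition projection_mat :: "nat \<Rightarrow> 'a::comm_ring_1 mat \<Rightarrow> bool" where
  "projection_mat n P \<longleftrightarrow> P \<in> carrier_mat n n \<and>
     (\<forall>v\<in>carrier_vec n. row_map P (row_map P v) = row_map P v)"

definition projection_onto :: "nat \<Rightarrow> 'a::comm_ring_1 mat \<Rightarrow> 'a vec set \<Rightarrow> bool" where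
  "projection_onto n P U \<longleftrightarrow> projection_mat n P \<and> row_map P ` carrier_vec n = U"

(* The inner product of v and w is that of the sum of v_i * conjugate w_i; over the reals
   conjugate is the identity. *)
definition orthogonal_projection :: "nat \<Rightarrow> 'a::conjugatable_field mat \<Rightarrow> bool" where
  "orthogonal_projection n P \<longleftrightarrow> projection_mat n P \<and>
     (\<forall>v\<in>carrier_vec n. \<forall>w\<in>row_map P ` carrier_vec n.
        row_map P v = 0\<^sub>v n \<longrightarrow> v \<bullet>c w = 0)"

lemma stochastic_mat_one: "stochastic_mat n (1\<^sub>m n)"
  by (auto simp: stochastic_mat_def)

lemma stochastic_mat_mult:
  assumes "stochastic_mat n A" "stochastic_mat n B"
  shows "stochastic_mat n (A * B)"
proof -
  have A: "A \<in> carrier_mat n n" and B: "B \<in> carrier_mat n n"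
    using assms by (auto simp: stochastic_mat_def)
  have e: "(A * B) $$ (i, j) = (\<Sum>k<n. A $$ (i, k) * B $$ (k, j))" if "i < n" "j < n" for i j
    using that A B by (auto simp: scalar_prod_def atLeast0LessThan intro!: sum.cong)
  have "(\<Sum>j<n. (A * B) $$ (i, j)) = 1" if i: "i < n" for i
  proof -
    have "(\<Sum>j<n. (A * B) $$ (i, j)) = (\<Sum>j<n. \<Sum>k<n. A $$ (i, k) * B $$ (k, j))"
      using e i by simp
    also have "\<dots> = (\<Sum>k<n. \<Sum>j<n. A $$ (i, k) * B $$ (k, j))" by (rule sum.swap)
    also have "\<dots> = (\<Sum>k<n. A $$ (i, k))"
      using assms(2) by (simp add: sum_distrib_left[symmetric] stochastic_mat_def)
    finally show ?thesis using assms(1) i by (simp add: stochastic_mat_def)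
  qed
  moreover have "0 \<le> (A * B) $$ (i, j)" if "i < n" "j < n" for i j
    unfolding e[OF that] using assms that by (auto simp: stochastic_mat_def intro!: sum_nonneg)
  ultimately show ?thesis using A B by (simp add: stochastic_mat_def)
qed

lemma stochastic_mat_pow:
  assumes "stochastic_mat n M" shows "stochastic_mat n (M ^\<^sub>m k)"
proof (induction k)
  case 0
  have "dim_row M = n" using assms by (auto simp: stochastic_mat_def)
  then show ?case by (simp add: stochastic_mat_one)
next
  case (Suc k)
  then show ?case by (simp add: stochastic_mat_mult assms)
qed

(* The series in geometric_mean converge, so suminf never takes its default value there. *)
lemma stochastic_geometric_mean_summable:
  assumes M: "stochastic_mat n M" and ij: "i < n" "j < n" and "0 < \<epsilon>" "\<epsilon> \<le> 1"
  shows "summable (\<lambda>k. (1 - \<epsilon>) ^ k * (M ^\<^sub>m k) $$ (i, j))"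
proof (rule summable_comparison_test')
  show "summable (\<lambda>k. (1 - \<epsilon>) ^ k)" using assms by (intro summable_geometric) auto
  fix k :: nat
  note s = stochastic_mat_pow[OF M, of k]
  have "(M ^\<^sub>m k) $$ (i, j) \<le> (\<Sum>j<n. (M ^\<^sub>m k) $$ (i, j))"
    using s ij by (intro member_le_sum) (auto simp: stochastic_mat_def)
  then have "(M ^\<^sub>m k) $$ (i, j) \<le> 1" "0 \<le> (M ^\<^sub>m k) $$ (i, j)"
    using s ij by (auto simp: stochastic_mat_def)
  then show "norm ((1 - \<epsilon>) ^ k * (M ^\<^sub>m k) $$ (i, j)) \<le> (1 - \<epsilon>) ^ k"
    using assms by (simp add: abs_mult mult_left_le)
qed

end

(* Powers of a stochastic matrix are stochastic, so the powers of J are bounded. A Jordan block of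
   size at least 2 with eigenvalue 1 would put the number k into its superdiagonal in the k-th power;
   hence all blocks with eigenvalue 1 have size 1, and D = diag(1 if J_ii = 1, else 0) satisfies
   J D = D J = D. The upper triangular matrix 1 - J + D has no zero on its diagonal, and its
   inverse V satisfies (1 - J) V = 1 - D. Conjugating by Q yields L and Z with M L = L M = L
   and (1 - M) Z = 1 - L. Each of the two means F satisfies F L = L and F - F M = c (1 - B) with B
   stochastic and c tending to 0, so F - L = F (1 - M) Z = c (1 - B) Z tends to 0.
   No bound on the other eigenvalues is needed. As a limit of real matrices, L is real. *)
theory Submission
  imports Defs
begin

section \<open>Power-bounded Jordan matrices\<close>

lemma index_mult_mat_sum:
  assumes "A \<in> carrier_mat m p" "B \<in> carrier_mat p q" "i < m" "j < q"
  shows "(A * B) $$ (i, j) = (\<Sum>k<p. A $$ (i, k) * B $$ (k, j))"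
  using assms by (auto simp: scalar_prod_def atLeast0LessThan intro!: sum.cong)

text \<open>Induction over the blocks: \<open>jordan_matrix_Cons\<close> gives a four-block matrix
  with zero outer blocks, so a nonzero entry has both indices in the first block or both shifted
  past its size \<open>m\<close>.\<close>

lemma jordan_matrix_off_bidiagonal:
  assumes "i < sum_list (map fst n_as)" "j < sum_list (map fst n_as)" "j \<noteq> i" "j \<noteq> Suc i"
  shows "jordan_matrix n_as $$ (i, j) = 0"
  using assms
proof (induction n_as arbitrary: i j)
  case (Cons na n_as)
  obtain m a where na: "na = (m, a)" by force
  show ?case
    using Cons.prems Cons.IH[of "i - m" "j - m"] unfolding na
    by (auto simp: jordan_matrix_Cons)
qed simp

text \<open>A nonzero superdiagonal entry cannot straddle two blocks, so \<open>i\<close> and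
  \<open>Suc i\<close> lie in one block and share its eigenvalue.\<close>

lemma jordan_matrix_superdiagonal:
  assumes "Suc i < sum_list (map fst n_as)" "jordan_matrix n_as $$ (i, Suc i) \<noteq> 0"
  shows "jordan_matrix n_as $$ (i, Suc i) = 1 \<and>
    jordan_matrix n_as $$ (Suc i, Suc i) = jordan_matrix n_as $$ (i, i)"
  using assms
proof (induction n_as arbitrary: i)
  case (Cons na n_as)
  obtain m a where na: "na = (m, a)" by force
  show ?case
    using Cons.prems Cons.IH[of "i - m"] unfolding na
    by (auto simp: jordan_matrix_Cons Suc_diff_le split: if_splits)
qed simp

text \<open>Row \<open>i\<close> of the powers, restricted to columns \<open>i\<close> and
  \<open>Suc i\<close>, evolves as for the 2x2 block with all three upper entries equal to 1: each
  step adds 1 to the superdiagonal entry.\<close>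

lemma bidiagonal_pow_entry:
  fixes J :: "'a::comm_ring_1 mat"
  assumes J: "J \<in> carrier_mat n n" and i: "Suc i < n"
    and off: "\<And>p q. p < n \<Longrightarrow> q < n \<Longrightarrow> q \<noteq> p \<Longrightarrow> q \<noteq> Suc p \<Longrightarrow> J $$ (p, q) = 0"
    and one: "J $$ (i, i) = 1" "J $$ (i, Suc i) = 1" "J $$ (Suc i, Suc i) = 1"
  shows "(J ^\<^sub>m k) $$ (i, Suc i) = of_nat k"
proof -
  \<comment> \<open>The zeros left of the diagonal strengthen the induction: otherwise column
    \<open>i - 1\<close> could feed column \<open>i\<close> through the superdiagonal of
    \<open>J\<close>.\<close>
  have "(\<forall>l<i. (J ^\<^sub>m k) $$ (i, l) = 0) \<and> (J ^\<^sub>m k) $$ (i, i) = 1 \<and> (J ^\<^sub>m k) $$ (i, Suc i) = of_nat k"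
  proof (induction k)
    case 0
    then show ?case using J i by auto
  next
    case (Suc k)
    have e: "(J ^\<^sub>m Suc k) $$ (i, l) = (\<Sum>p<n. (J ^\<^sub>m k) $$ (i, p) * J $$ (p, l))" if "l < n" for l
      using index_mult_mat_sum[OF pow_carrier_mat[OF J] J, of i l k] that i by simp
    have "(J ^\<^sub>m Suc k) $$ (i, l) = 0" if l: "l < i" for l
    proof -
      have "(J ^\<^sub>m k) $$ (i, p) * J $$ (p, l) = 0" if "p < n" for p
        using Suc off[of p l] that l i by (cases "p < i") auto
      then show ?thesis using e[of l] l i by simp
    qed
    moreover have "(J ^\<^sub>m Suc k) $$ (i, i) = 1"
    proof -
      have "(J ^\<^sub>m k) $$ (i, p) * J $$ (p, i) = (if p = i then 1 else 0)" if "p < n" for p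
        using Suc off[of p i] that i one by (cases "p < i") auto
      then show ?thesis using e[of i] i by simp
    qed
    moreover have "(J ^\<^sub>m Suc k) $$ (i, Suc i) = of_nat (Suc k)"
    proof -
      have "(J ^\<^sub>m k) $$ (i, p) * J $$ (p, Suc i) =
          (if p = i then 1 else 0) + (if p = Suc i then of_nat k else 0)" if "p < n" for p
        using Suc off[of p "Suc i"] that i one by (cases "p < i") auto
      then show ?thesis using e[of "Suc i"] i by (simp add: sum.distrib)
    qed
    ultimately show ?case by blast
  qed
  then show ?thesis by simp
qed

text \<open>A nonzero entry here would sit on the superdiagonal of a block with eigenvalue 1, and
  its growth like \<open>k\<close> contradicts the bound \<open>b i j\<close>, which does not depend
  on \<open>k\<close>. Of the two cases in \<open>one\<close>, the row case serves
  \<open>D * J = D\<close> and the column case \<open>J * D = D\<close>.\<close>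

lemma power_bounded_jordan_matrix_unit_eigenvalue:
  fixes n_as :: "(nat \<times> 'k::real_normed_field) list"
  defines "J \<equiv> jordan_matrix n_as"
  assumes J: "J \<in> carrier_mat n n"
    and bdd: "\<And>k i j. i < n \<Longrightarrow> j < n \<Longrightarrow> norm ((J ^\<^sub>m k) $$ (i, j)) \<le> b i j"
    and ij: "i < n" "j < n" "i \<noteq> j" and one: "J $$ (i, i) = 1 \<or> J $$ (j, j) = 1"
  shows "J $$ (i, j) = 0"
proof (rule ccontr)
  assume nz: "J $$ (i, j) \<noteq> 0"
  have n: "sum_list (map fst n_as) = n" using J by (auto simp: J_def)
  have off: "J $$ (p, q) = 0" if "p < n" "q < n" "q \<noteq> p" "q \<noteq> Suc p" for p q
    using jordan_matrix_off_bidiagonal[of p n_as q] that by (simp add: n J_def)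
  have j: "j = Suc i" using off[of i j] nz ij by auto
  have "J $$ (i, Suc i) = 1" "J $$ (i, i) = 1" "J $$ (Suc i, Suc i) = 1"
    using jordan_matrix_superdiagonal[of i n_as] nz ij one by (auto simp: n J_def j)
  then have "(J ^\<^sub>m k) $$ (i, j) = of_nat k" for k
    using bidiagonal_pow_entry[OF J _ off] ij unfolding j by blast
  then have "real k \<le> b i j" for k using bdd[of i j k] ij by simp
  then show False by (meson not_le reals_Archimedean2)
qed

text \<open>The matrix \<open>1 - J\<close> is singular once 1 is an eigenvalue; \<open>V\<close>
  replaces its inverse modulo \<open>D\<close>. This identity later yields both the fixed vectors
  and the convergence.\<close>

lemma jordan_matrix_fix_projection:
  fixes n :: nat and n_as :: "(nat \<times> 'k::real_normed_field) list"
  defines "J \<equiv> jordan_matrix n_as"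
    and "D \<equiv> mat n n (\<lambda>(i, j). if i = j \<and> jordan_matrix n_as $$ (i, i) = 1 then 1 else 0)"
  assumes J: "J \<in> carrier_mat n n"
    and bdd: "\<And>k i j. i < n \<Longrightarrow> j < n \<Longrightarrow> norm ((J ^\<^sub>m k) $$ (i, j)) \<le> b i j"
  shows "J * D = D" "D * J = D"
    "\<exists>V\<in>carrier_mat n n. (1\<^sub>m n - J) * V = 1\<^sub>m n - D"
proof -
  have n: "sum_list (map fst n_as) = n" using J by (auto simp: J_def)
  have D: "D \<in> carrier_mat n n" by (simp add: D_def)
  have De: "D $$ (i, j) = (if i = j \<and> J $$ (i, i) = 1 then 1 else 0)" if "i < n" "j < n" for i j
    using that by (simp add: D_def J_def)
  have diag: "J $$ (i, j) = 0" if "i < n" "j < n" "i \<noteq> j" "J $$ (i, i) = 1 \<or> J $$ (j, j) = 1" for i j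
    using power_bounded_jordan_matrix_unit_eigenvalue[of n_as n b i j] J bdd that by (simp add: J_def)
  show JD: "J * D = D"
  proof (rule eq_matI)
    fix i j assume "i < dim_row D" "j < dim_col D"
    then have ij: "i < n" "j < n" using D by auto
    have "J $$ (i, k) * D $$ (k, j) = (if k = j then D $$ (i, j) else 0)" if "k < n" for k
      using ij that diag[of i j] by (auto simp: De)
    then show "(J * D) $$ (i, j) = D $$ (i, j)"
      using ij by (simp add: index_mult_mat_sum[OF J D])
  qed (use J D in auto)
  show DJ: "D * J = D"
  proof (rule eq_matI)
    fix i j assume "i < dim_row D" "j < dim_col D"
    then have ij: "i < n" "j < n" using D by auto
    have "D $$ (i, k) * J $$ (k, j) = (if k = i then D $$ (i, j) else 0)" if "k < n" for k
      using ij that diag[of i j] by (auto simp: De)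
    then show "(D * J) $$ (i, j) = D $$ (i, j)"
      using ij by (simp add: index_mult_mat_sum[OF D J])
  qed (use J D in auto)
  \<comment> \<open>Adding \<open>D\<close> puts a 1 exactly where the diagonal of
    \<open>1 - J\<close> vanishes, so the triangular \<open>W\<close> has nonzero
    determinant.\<close>
  define W where "W = 1\<^sub>m n - J + D"
  have W: "W \<in> carrier_mat n n" using J D by (auto simp: W_def)
  have DD: "D * D = D"
  proof (rule eq_matI)
    fix i j assume "i < dim_row D" "j < dim_col D"
    then have ij: "i < n" "j < n" using D by auto
    have "D $$ (i, k) * D $$ (k, j) = (if k = i then D $$ (i, j) else 0)" if "k < n" for k
      using ij that by (auto simp: De)
    then show "(D * D) $$ (i, j) = D $$ (i, j)"
      using ij by (simp add: index_mult_mat_sum[OF D D])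
  qed (use D in auto)
  have "upper_triangular W"
    using J D jordan_matrix_upper_triangular[of _ n_as]
    by (auto simp: W_def De n J_def[symmetric])
  then have "det W = prod_list (diag_mat W)" by (rule det_upper_triangular[OF _ W])
  moreover have "0 \<notin> set (diag_mat W)"
    using J D by (auto simp: W_def De diag_mat_def split: if_splits)
  ultimately have "det W \<noteq> 0" by (simp add: prod_list_zero_iff)
  then obtain V where V: "V \<in> carrier_mat n n" and WV: "W * V = 1\<^sub>m n"
    \<comment> \<open>The value \<open>()\<close> only fills the extension field of the ring
      record.\<close>
    using det_non_zero_imp_unit[OF W, of "()"] by (auto simp: Units_def ring_mat_simps)
  \<comment> \<open>Since \<open>D\<close> absorbs \<open>W\<close>, it also absorbs the inverse
    \<open>V\<close>; this removes \<open>V\<close> from the summand \<open>D * V\<close> of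
    \<open>W * V = 1\<close>.\<close>
  have DW: "D * W = D"
  proof -
    have "D * W = D * (1\<^sub>m n - J) + D * D"
      unfolding W_def using J D by (intro mult_add_distrib_mat) auto
    also have "D * (1\<^sub>m n - J) = D - D"
      using J D DJ by (subst mult_minus_distrib_mat) auto
    finally show ?thesis using D DD by simp
  qed
  have DV: "D * V = D"
    using assoc_mult_mat[OF D W V] D by (simp add: WV DW)
  have "(1\<^sub>m n - J) * V + D * V = W * V"
    unfolding W_def using J D V by (intro add_mult_distrib_mat[symmetric]) auto
  then have eq: "(1\<^sub>m n - J) * V + D = 1\<^sub>m n" by (simp add: WV DV)
  have "(1\<^sub>m n - J) * V = 1\<^sub>m n - D"
  proof (rule eq_matI)
    fix i j assume "i < dim_row (1\<^sub>m n - D)" "j < dim_col (1\<^sub>m n - D)"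
    then have ij: "i < n" "j < n" using D by auto
    have "((1\<^sub>m n - J) * V + D) $$ (i, j) = ((1\<^sub>m n - J) * V) $$ (i, j) + D $$ (i, j)"
      using ij D by (intro index_add_mat) auto
    then show "((1\<^sub>m n - J) * V) $$ (i, j) = (1\<^sub>m n - D) $$ (i, j)"
      using ij D unfolding eq by simp
  qed (use J V D in auto)
  then show "\<exists>V\<in>carrier_mat n n. (1\<^sub>m n - J) * V = 1\<^sub>m n - D" using V by blast
qed


section \<open>Projections onto fixed spaces\<close>

text \<open>Applying \<open>row_map P\<close> and then \<open>row_map A\<close> is
  \<open>row_map (P * A)\<close>, so \<open>P * A = P\<close> puts the image inside the fixed space.
  As \<open>P\<close> is the identity there, the image is the whole space and \<open>P\<close> is
  idempotent.\<close>

lemma projection_onto_fix_space: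
  assumes A: "A \<in> carrier_mat n n" and P: "P \<in> carrier_mat n n" and PA: "P * A = P"
    and fixed: "\<And>v. v \<in> fix_space n A \<Longrightarrow> row_map P v = v"
  shows "projection_onto n P (fix_space n A)"
proof -
  have im: "row_map P v \<in> fix_space n A" if v: "v \<in> carrier_vec n" for v
  proof -
    have "transpose_mat A *\<^sub>v (transpose_mat P *\<^sub>v v) = transpose_mat (P * A) *\<^sub>v v"
      using A P v by (simp add: transpose_mult[OF P A])
    then show ?thesis using P v by (simp add: PA fix_space_def row_map_def)
  qed
  then have "row_map P ` carrier_vec n = fix_space n A"
    using fixed by (force simp: fix_space_def image_iff)
  then show ?thesis
    using im fixed P by (simp add: projection_onto_def projection_mat_def)
qed

text \<open>A fixed row vector is annihilated by \<open>1 - A\<close>, the left factor in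
  \<open>AZ\<close>, hence also by \<open>1 - P\<close>.\<close>

lemma row_map_fix_space:
  fixes A :: "'a::comm_ring_1 mat"
  assumes A: "A \<in> carrier_mat n n" and P: "P \<in> carrier_mat n n" and Z: "Z \<in> carrier_mat n n"
    and AZ: "(1\<^sub>m n - A) * Z = 1\<^sub>m n - P" and v: "v \<in> fix_space n A"
  shows "row_map P v = v"
proof -
  have vc: "v \<in> carrier_vec n" and Av: "transpose_mat A *\<^sub>v v = v"
    using v by (auto simp: fix_space_def row_map_def)
  have minus: "transpose_mat (1\<^sub>m n - B) *\<^sub>v v = v - transpose_mat B *\<^sub>v v"
    if B: "B \<in> carrier_mat n n" for B :: "'a mat"
  proof -
    have "transpose_mat (1\<^sub>m n - B) = 1\<^sub>m n - transpose_mat B"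
      using B by (intro eq_matI) auto
    then show ?thesis using B vc by (simp add: minus_mult_distrib_mat_vec[of _ n n])
  qed
  have A1: "1\<^sub>m n - A \<in> carrier_mat n n" using A by (rule minus_carrier_mat)
  have "v - transpose_mat P *\<^sub>v v = transpose_mat ((1\<^sub>m n - A) * Z) *\<^sub>v v"
    unfolding AZ by (rule minus[OF P, symmetric])
  also have "\<dots> = transpose_mat Z *\<^sub>v (transpose_mat (1\<^sub>m n - A) *\<^sub>v v)"
    using A1 Z vc by (simp add: transpose_mult[OF A1 Z] del: transpose_minus)
  also have "\<dots> = 0\<^sub>v n"
    unfolding minus[OF A] Av using Z vc by (auto intro!: eq_vecI)
  finally have eq: "v - transpose_mat P *\<^sub>v v = 0\<^sub>v n" .
  show ?thesis
  proof (rule eq_vecI)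
    fix i assume "i < dim_vec v"
    then have i: "i < n" using vc by auto
    have "(v - transpose_mat P *\<^sub>v v) $ i = v $ i - (transpose_mat P *\<^sub>v v) $ i"
      using i P by (intro index_minus_vec) auto
    then show "row_map P v $ i = v $ i" using i unfolding eq by (simp add: row_map_def)
  qed (use P vc in \<open>auto simp: row_map_def\<close>)
qed

text \<open>A diagonal matrix acts coordinatewise: for \<open>v\<close> in the kernel, each
  \<open>i\<close> has \<open>P $$ (i, i) = 0\<close> or \<open>v $ i = 0\<close>, so the inner
  product with any image vector vanishes term by term.\<close>

lemma orthogonal_projection_diagonal:
  fixes P :: "'a::conjugatable_field mat"
  assumes P: "projection_mat n P" and diag: "\<And>i j. i < n \<Longrightarrow> j < n \<Longrightarrow> i \<noteq> j \<Longrightarrow> P $$ (i, j) = 0"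
  shows "orthogonal_projection n P"
proof -
  have Pc: "P \<in> carrier_mat n n" using P by (simp add: projection_mat_def)
  have ent: "row_map P v $ i = P $$ (i, i) * v $ i" if v: "v \<in> carrier_vec n" and i: "i < n" for v i
  proof -
    have "row_map P v $ i = (\<Sum>k<n. P $$ (k, i) * v $ k)"
      using v i Pc by (auto simp: row_map_def scalar_prod_def atLeast0LessThan intro!: sum.cong)
    also have "\<dots> = (\<Sum>k<n. if k = i then P $$ (i, i) * v $ i else 0)"
      using i diag by (intro sum.cong) auto
    finally show ?thesis using i by simp
  qed
  have "v \<bullet>c row_map P u = 0"
    if v: "v \<in> carrier_vec n" and u: "u \<in> carrier_vec n" and z: "row_map P v = 0\<^sub>v n" for u v
  proof -
    have "v $ i * conjugate (row_map P u $ i) = 0" if i: "i < n" for i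
    proof -
      have "P $$ (i, i) * v $ i = 0" using ent[OF v i] z i by simp
      then show ?thesis using ent[OF u i] by auto
    qed
    then show ?thesis using Pc u v by (auto simp: scalar_prod_def row_map_def intro!: sum.neutral)
  qed
  then show ?thesis using P by (auto simp: orthogonal_projection_def)
qed


section \<open>Convergence of the means\<close>

text \<open>As \<open>of_real\<close> is isometric, the sequence is Cauchy already in the reals;
  completeness there gives a limit, and limits are unique.\<close>

lemma LIMSEQ_of_real_imp_real_limit:
  fixes L :: "'a::real_normed_algebra_1"
  assumes "(\<lambda>N. of_real (f N)) \<longlonglongrightarrow> L"
  obtains r where "L = of_real r"
proof -
  have "Cauchy (\<lambda>N. of_real (f N) :: 'a)" using assms by (rule LIMSEQ_imp_Cauchy)
  then have "Cauchy f"
    by (simp add: Cauchy_def dist_norm flip: of_real_diff)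
  then obtain r where "f \<longlonglongrightarrow> r" using Cauchy_convergent convergent_def by blast
  then have "(\<lambda>N. of_real (f N) :: 'a) \<longlonglongrightarrow> of_real r" by (rule tendsto_of_real)
  then show thesis using that LIMSEQ_unique[OF assms] by blast
qed

lemma stochastic_mat_entry:
  assumes "stochastic_mat n M" "i < n" "j < n"
  shows "0 \<le> M $$ (i, j)" "M $$ (i, j) \<le> 1"
proof -
  have "M $$ (i, j) \<le> (\<Sum>j<n. M $$ (i, j))"
    using assms by (intro member_le_sum) (auto simp: stochastic_mat_def)
  then show "0 \<le> M $$ (i, j)" "M $$ (i, j) \<le> 1"
    using assms by (auto simp: stochastic_mat_def)
qed

text \<open>Both means are instances: \<open>c\<close> and \<open>B\<close> are \<open>1 / N\<close>
  and the \<open>N\<close>-th power of \<open>M\<close> for the ergodic mean,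
  \<open>\<epsilon>\<close> and the geometric mean times \<open>M\<close> for the other. The limit
  \<open>L\<close> has entries in \<open>'k\<close> because it is built from the Jordan
  basis.\<close>

lemma mean_tendsto_fix_projection:
  fixes L Z :: "'k::real_normed_field mat" and F B :: "'b \<Rightarrow> real mat"
  assumes M: "M \<in> carrier_mat n n" and L: "L \<in> carrier_mat n n" and Z: "Z \<in> carrier_mat n n"
    and MZ: "(1\<^sub>m n - map_mat of_real M) * Z = 1\<^sub>m n - L"
    and ev: "\<forall>\<^sub>F x in net. F x \<in> carrier_mat n n \<and> stochastic_mat n (B x) \<and>
      F x - F x * M = c x \<cdot>\<^sub>m (1\<^sub>m n - B x) \<and> map_mat of_real (F x) * L = L"
    and c: "(c \<longlongrightarrow> 0) net" and ij: "i < n" "j < n"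
  shows "((\<lambda>x. of_real (F x $$ (i, j))) \<longlongrightarrow> L $$ (i, j)) net"
proof -
  \<comment> \<open>This bounds entry \<open>(i, j)\<close> of \<open>(1 - B) * Z\<close> for every
    stochastic \<open>B\<close>, whose entries lie between 0 and 1.\<close>
  let ?K = "norm (Z $$ (i, j)) + (\<Sum>k<n. norm (Z $$ (k, j)))"
  have "\<forall>\<^sub>F x in net. norm (of_real (F x $$ (i, j)) - L $$ (i, j)) \<le> \<bar>c x\<bar> * ?K"
    using ev
  proof eventually_elim
    case (elim x)
    let ?F = "map_mat of_real (F x) :: 'k mat" and ?A = "map_mat of_real M :: 'k mat"
    have Fc: "F x \<in> carrier_mat n n" using elim by blast
    have F: "?F \<in> carrier_mat n n" and A: "?A \<in> carrier_mat n n" using elim M by auto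
    have B: "B x \<in> carrier_mat n n" using elim by (simp add: stochastic_mat_def)
    have hom: "map_mat of_real (F x * M) = ?F * ?A"
      using elim M by (intro of_real_hom.mat_hom_mult) auto
    have defect: "(?F * (1\<^sub>m n - ?A)) $$ (p, q) = of_real (c x * ((if p = q then 1 else 0) - B x $$ (p, q)))"
      if pq: "p < n" "q < n" for p q
    proof -
      have "?F * (1\<^sub>m n - ?A) = ?F - ?F * ?A"
        using F A by (subst mult_minus_distrib_mat) auto
      also have "\<dots> $$ (p, q) = of_real ((F x - F x * M) $$ (p, q))"
        unfolding hom[symmetric] using pq Fc M by (simp del: index_mult_mat(1))
      also have "(F x - F x * M) $$ (p, q) = c x * ((if p = q then 1 else 0) - B x $$ (p, q))"
        using elim pq B by simp
      finally show ?thesis .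
    qed
    \<comment> \<open>Here \<open>?F * L = L\<close> enters; \<open>MZ\<close> then exposes the
      factor \<open>?F * (1 - ?A)\<close>, which is small by \<open>defect\<close>.\<close>
    have "?F - L = ?F * (1\<^sub>m n - L)"
      using elim F L by (subst mult_minus_distrib_mat) auto
    also have "\<dots> = ?F * (1\<^sub>m n - ?A) * Z"
      unfolding MZ[symmetric] using F A Z by (intro assoc_mult_mat[symmetric]) auto
    finally have eq: "?F - L = ?F * (1\<^sub>m n - ?A) * Z" .
    have "of_real (F x $$ (i, j)) - L $$ (i, j) = (?F - L) $$ (i, j)"
      using ij elim L by auto
    also have "\<dots> = (\<Sum>k<n. (?F * (1\<^sub>m n - ?A)) $$ (i, k) * Z $$ (k, j))"
      unfolding eq using ij F A Z by (intro index_mult_mat_sum) auto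
    also have "\<dots> = (\<Sum>k<n. of_real (c x) *
        ((if k = i then Z $$ (i, j) else 0) - of_real (B x $$ (i, k)) * Z $$ (k, j)))"
      using ij by (intro sum.cong) (auto simp: defect algebra_simps)
    also have "\<dots> = of_real (c x) * (Z $$ (i, j) - (\<Sum>k<n. of_real (B x $$ (i, k)) * Z $$ (k, j)))"
      using ij by (simp add: sum_subtractf flip: sum_distrib_left)
    finally have "norm (of_real (F x $$ (i, j)) - L $$ (i, j)) =
        \<bar>c x\<bar> * norm (Z $$ (i, j) - (\<Sum>k<n. of_real (B x $$ (i, k)) * Z $$ (k, j)))"
      by (simp add: norm_mult)
    also have "norm (Z $$ (i, j) - (\<Sum>k<n. of_real (B x $$ (i, k)) * Z $$ (k, j))) \<le>
        norm (Z $$ (i, j)) + norm (\<Sum>k<n. of_real (B x $$ (i, k)) * Z $$ (k, j))"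
      by (rule norm_triangle_ineq4)
    also have "norm (\<Sum>k<n. of_real (B x $$ (i, k)) * Z $$ (k, j)) \<le>
        (\<Sum>k<n. norm (Z $$ (k, j)))"
      using elim ij
      by (intro sum_norm_le)
        (auto simp: norm_mult intro!: mult_left_le_one_le stochastic_mat_entry abs_leI
          order_trans[OF _ stochastic_mat_entry(1)])
    finally show ?case by (simp add: mult_left_mono)
  qed
  then have "((\<lambda>x. of_real (F x $$ (i, j)) - L $$ (i, j)) \<longlongrightarrow> 0) net"
    by (intro tendsto_0_le[OF c]) simp
  then show ?thesis by (rule LIM_zero_cancel)
qed

section \<open>The ergodic mean\<close>

lemma ergodic_mean_carrier:
  "M \<in> carrier_mat n n \<Longrightarrow> ergodic_mean M N \<in> carrier_mat n n"
  by (auto simp: ergodic_mean_def)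

text \<open>Multiplying by \<open>M\<close> shifts every exponent by one, so the difference
  telescopes. At \<open>N = 0\<close> both sides are the zero matrix, as
  \<open>1 / 0 = 0\<close>.\<close>

lemma ergodic_mean_defect:
  assumes M: "M \<in> carrier_mat n n"
  shows "ergodic_mean M N - ergodic_mean M N * M = (1 / real N) \<cdot>\<^sub>m (1\<^sub>m n - M ^\<^sub>m N)"
proof (rule eq_matI)
  fix i j assume "i < dim_row ((1 / real N) \<cdot>\<^sub>m (1\<^sub>m n - M ^\<^sub>m N))"
    "j < dim_col ((1 / real N) \<cdot>\<^sub>m (1\<^sub>m n - M ^\<^sub>m N))"
  then have ij: "i < n" "j < n" using pow_carrier_mat[OF M, of N] by auto
  note S = ergodic_mean_carrier[OF M, of N]
  have "(ergodic_mean M N * M) $$ (i, j) =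
      (\<Sum>l<n. 1 / real N * (\<Sum>k<N. (M ^\<^sub>m k) $$ (i, l)) * M $$ (l, j))"
    using ij M by (subst index_mult_mat_sum[OF S M]) (auto simp: ergodic_mean_def)
  also have "\<dots> = 1 / real N * (\<Sum>k<N. \<Sum>l<n. (M ^\<^sub>m k) $$ (i, l) * M $$ (l, j))"
    by (subst sum.swap) (simp add: sum_distrib_left sum_distrib_right mult_ac)
  also have "\<dots> = 1 / real N * (\<Sum>k<N. (M ^\<^sub>m Suc k) $$ (i, j))"
    using ij index_mult_mat_sum[OF pow_carrier_mat[OF M] M] by simp
  finally have "(ergodic_mean M N - ergodic_mean M N * M) $$ (i, j) =
      1 / real N * (\<Sum>k<N. (M ^\<^sub>m k) $$ (i, j) - (M ^\<^sub>m Suc k) $$ (i, j))"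
    using ij M S by (simp add: ergodic_mean_def sum_subtractf algebra_simps del: pow_mat.simps)
  also have "\<dots> = 1 / real N * ((M ^\<^sub>m 0) $$ (i, j) - (M ^\<^sub>m N) $$ (i, j))"
    by (subst sum_lessThan_telescope') simp
  finally show "(ergodic_mean M N - ergodic_mean M N * M) $$ (i, j) =
      ((1 / real N) \<cdot>\<^sub>m (1\<^sub>m n - M ^\<^sub>m N)) $$ (i, j)"
    using ij M by simp
qed (use M in \<open>auto simp: ergodic_mean_def\<close>)

lemma pow_mat_mult_fixed:
  assumes A: "A \<in> carrier_mat n n" and L: "L \<in> carrier_mat n n" and AL: "A * L = L"
  shows "A ^\<^sub>m k * L = L"
proof (induction k)
  case (Suc k)
  have "A ^\<^sub>m Suc k * L = A ^\<^sub>m k * (A * L)"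
    using assoc_mult_mat[OF pow_carrier_mat[OF A] A L, of k] by simp
  then show ?case using Suc AL by simp
qed (use A L in simp)

text \<open>Every power of \<open>M\<close> fixes \<open>L\<close>, so this is an average of
  \<open>N\<close> copies of \<open>L\<close>. The mean for \<open>N = 0\<close> is the zero matrix,
  which is excluded.\<close>

lemma ergodic_mean_mult_fixed:
  fixes L :: "'k::real_normed_field mat"
  assumes M: "M \<in> carrier_mat n n" and L: "L \<in> carrier_mat n n"
    and fixL: "map_mat of_real M * L = L" and N: "N > 0"
  shows "map_mat of_real (ergodic_mean M N) * L = L"
proof (rule eq_matI)
  let ?A = "map_mat of_real M :: 'k mat"
  fix i j assume "i < dim_row L" "j < dim_col L"
  then have ij: "i < n" "j < n" using L by auto
  have A: "?A \<in> carrier_mat n n" using M by simp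
  have S: "map_mat of_real (ergodic_mean M N) \<in> carrier_mat n n"
    using ergodic_mean_carrier[OF M] by simp
  have pw: "of_real ((M ^\<^sub>m k) $$ (i, l)) = (?A ^\<^sub>m k) $$ (i, l)" if "l < n" for k l
    using that ij M by (simp flip: of_real_hom.mat_hom_pow[OF M])
  have "(map_mat of_real (ergodic_mean M N) * L) $$ (i, j) =
      (\<Sum>l<n. 1 / of_nat N * (\<Sum>k<N. (?A ^\<^sub>m k) $$ (i, l)) * L $$ (l, j))"
    using ij M by (subst index_mult_mat_sum[OF S L]) (auto simp: ergodic_mean_def pw)
  also have "\<dots> = 1 / of_nat N * (\<Sum>k<N. \<Sum>l<n. (?A ^\<^sub>m k) $$ (i, l) * L $$ (l, j))"
    by (subst sum.swap) (simp add: sum_distrib_left sum_distrib_right mult_ac)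
  also have "\<dots> = 1 / of_nat N * (\<Sum>k<N. (?A ^\<^sub>m k * L) $$ (i, j))"
    using ij index_mult_mat_sum[OF pow_carrier_mat[OF A] L] by simp
  also have "\<dots> = L $$ (i, j)"
    using N by (simp add: pow_mat_mult_fixed[OF A L fixL])
  finally show "(map_mat of_real (ergodic_mean M N) * L) $$ (i, j) = L $$ (i, j)" .
qed (use M L in \<open>auto simp: ergodic_mean_def\<close>)

section \<open>The geometric mean\<close>

lemma geometric_mean_carrier:
  "M \<in> carrier_mat n n \<Longrightarrow> geometric_mean M \<epsilon> \<in> carrier_mat n n"
  by (auto simp: geometric_mean_def)

text \<open>The weights form a geometric series with sum 1, and a finite row sum commutes with the
  series. This makes the geometric mean times \<open>M\<close> stochastic, as the convergence lemma
  requires of \<open>B\<close>.\<close>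

lemma stochastic_geometric_mean:
  assumes M: "stochastic_mat n M" and e: "0 < \<epsilon>" "\<epsilon> \<le> 1"
  shows "stochastic_mat n (geometric_mean M \<epsilon>)"
proof -
  have Mc: "M \<in> carrier_mat n n" using M by (simp add: stochastic_mat_def)
  note sm = stochastic_geometric_mean_summable[OF M _ _ e]
  have "(\<Sum>j<n. geometric_mean M \<epsilon> $$ (i, j)) = 1" if i: "i < n" for i
  proof -
    have "(\<Sum>j<n. geometric_mean M \<epsilon> $$ (i, j)) =
        \<epsilon> * (\<Sum>j<n. \<Sum>k. (1 - \<epsilon>) ^ k * (M ^\<^sub>m k) $$ (i, j))"
      using i Mc by (simp add: geometric_mean_def sum_distrib_left)
    also have "\<dots> = \<epsilon> * (\<Sum>k. \<Sum>j<n. (1 - \<epsilon>) ^ k * (M ^\<^sub>m k) $$ (i, j))"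
      using i sm by (subst suminf_sum) auto
    also have "\<dots> = \<epsilon> * (\<Sum>k. (1 - \<epsilon>) ^ k)"
      using i stochastic_mat_pow[OF M] by (simp add: stochastic_mat_def flip: sum_distrib_left)
    also have "\<dots> = 1" using e by (subst suminf_geometric) auto
    finally show ?thesis .
  qed
  moreover have "0 \<le> geometric_mean M \<epsilon> $$ (i, j)" if ij: "i < n" "j < n" for i j
  proof -
    have "0 \<le> (\<Sum>k. (1 - \<epsilon>) ^ k * (M ^\<^sub>m k) $$ (i, j))"
      using e ij stochastic_mat_entry(1)[OF stochastic_mat_pow[OF M]]
      by (intro suminf_nonneg sm) auto
    then show ?thesis using ij Mc e by (simp add: geometric_mean_def)
  qed
  ultimately show ?thesis
    using geometric_mean_carrier[OF Mc] by (simp add: stochastic_mat_def)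
qed

text \<open>Splitting off the term \<open>k = 0\<close> gives
  \<open>G = \<epsilon> * 1 + (1 - \<epsilon>) * G * M\<close> for the mean \<open>G\<close>; the
  claim is a rearrangement.\<close>

lemma geometric_mean_defect:
  assumes M: "stochastic_mat n M" and e: "0 < \<epsilon>" "\<epsilon> \<le> 1"
  shows "geometric_mean M \<epsilon> - geometric_mean M \<epsilon> * M = \<epsilon> \<cdot>\<^sub>m (1\<^sub>m n - geometric_mean M \<epsilon> * M)"
proof (rule eq_matI)
  fix i j assume "i < dim_row (\<epsilon> \<cdot>\<^sub>m (1\<^sub>m n - geometric_mean M \<epsilon> * M))"
    "j < dim_col (\<epsilon> \<cdot>\<^sub>m (1\<^sub>m n - geometric_mean M \<epsilon> * M))"
  moreover have Mc: "M \<in> carrier_mat n n" using M by (simp add: stochastic_mat_def)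
  note G = geometric_mean_carrier[OF Mc, of \<epsilon>]
  ultimately have ij: "i < n" "j < n" using Mc by auto
  note sm = stochastic_geometric_mean_summable[OF M _ _ e]
  let ?x = "1 - \<epsilon>"
  have sm2: "summable (\<lambda>k. ?x ^ k * ((M ^\<^sub>m k) $$ (i, l) * M $$ (l, j)))" if "l < n" for l
    using summable_mult2[OF sm[OF ij(1) that]] by (simp add: mult_ac)
  have "(geometric_mean M \<epsilon> * M) $$ (i, j) =
      (\<Sum>l<n. \<epsilon> * (\<Sum>k. ?x ^ k * (M ^\<^sub>m k) $$ (i, l)) * M $$ (l, j))"
    using ij Mc by (subst index_mult_mat_sum[OF G Mc]) (auto simp: geometric_mean_def)
  also have "\<dots> = \<epsilon> * (\<Sum>l<n. \<Sum>k. ?x ^ k * ((M ^\<^sub>m k) $$ (i, l) * M $$ (l, j)))"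
    unfolding sum_distrib_left
    using suminf_mult2[OF sm[OF ij(1)]] by (intro sum.cong) (auto simp: mult.assoc)
  also have "\<dots> = \<epsilon> * (\<Sum>k. \<Sum>l<n. ?x ^ k * ((M ^\<^sub>m k) $$ (i, l) * M $$ (l, j)))"
    using sm2 by (subst suminf_sum) auto
  also have "\<dots> = \<epsilon> * (\<Sum>k. ?x ^ k * (M ^\<^sub>m Suc k) $$ (i, j))"
    using ij index_mult_mat_sum[OF pow_carrier_mat[OF Mc] Mc] by (simp flip: sum_distrib_left)
  finally have GM: "(geometric_mean M \<epsilon> * M) $$ (i, j) = \<epsilon> * (\<Sum>k. ?x ^ k * (M ^\<^sub>m Suc k) $$ (i, j))" .
  \<comment> \<open>The exponents of \<open>?x\<close> and \<open>M\<close> differ by one, and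
    dividing a shifted series by \<open>?x\<close> fails at \<open>\<epsilon> = 1\<close>; a finite
    sum of the series in \<open>sm2\<close> works for all \<open>\<epsilon>\<close>.\<close>
  have sS: "summable (\<lambda>k. ?x ^ k * (M ^\<^sub>m Suc k) $$ (i, j))"
  proof -
    have "summable (\<lambda>k. \<Sum>l<n. ?x ^ k * ((M ^\<^sub>m k) $$ (i, l) * M $$ (l, j)))"
      using sm2 by (intro summable_sum) auto
    then show ?thesis
      using ij index_mult_mat_sum[OF pow_carrier_mat[OF Mc] Mc] by (simp flip: sum_distrib_left)
  qed
  have "geometric_mean M \<epsilon> $$ (i, j) = \<epsilon> * (\<Sum>k. ?x ^ k * (M ^\<^sub>m k) $$ (i, j))"
    using ij Mc by (simp add: geometric_mean_def)
  also have "(\<Sum>k. ?x ^ k * (M ^\<^sub>m k) $$ (i, j)) =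
      (\<Sum>k. ?x ^ Suc k * (M ^\<^sub>m Suc k) $$ (i, j)) + 1\<^sub>m n $$ (i, j)"
    using suminf_split_head[OF sm[OF ij]] Mc by simp
  also have "(\<Sum>k. ?x ^ Suc k * (M ^\<^sub>m Suc k) $$ (i, j)) =
      ?x * (\<Sum>k. ?x ^ k * (M ^\<^sub>m Suc k) $$ (i, j))"
    using suminf_mult[OF sS, of ?x] by (simp add: mult_ac del: pow_mat.simps)
  finally have "geometric_mean M \<epsilon> $$ (i, j) =
      ?x * (geometric_mean M \<epsilon> * M) $$ (i, j) + \<epsilon> * 1\<^sub>m n $$ (i, j)"
    unfolding GM by (simp add: algebra_simps del: pow_mat.simps)
  then show "(geometric_mean M \<epsilon> - geometric_mean M \<epsilon> * M) $$ (i, j) =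
      (\<epsilon> \<cdot>\<^sub>m (1\<^sub>m n - geometric_mean M \<epsilon> * M)) $$ (i, j)"
    using ij Mc G by (simp add: algebra_simps del: index_mult_mat(1))
qed (use geometric_mean_carrier[of M n \<epsilon>] M in \<open>auto simp: stochastic_mat_def\<close>)

text \<open>The defect identity, multiplied by \<open>L\<close>, reads
  \<open>G * L = (1 - \<epsilon>) * G * L + \<epsilon> * L\<close>, and \<open>\<epsilon>\<close>
  cancels. Thus no series over \<open>'k\<close> has to be handled.\<close>

lemma geometric_mean_mult_fixed:
  fixes L :: "'k::real_normed_field mat"
  assumes M: "stochastic_mat n M" and e: "0 < \<epsilon>" "\<epsilon> \<le> 1" and L: "L \<in> carrier_mat n n"
    and fixL: "map_mat of_real M * L = L"
  shows "map_mat of_real (geometric_mean M \<epsilon>) * L = L"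
proof (rule eq_matI)
  let ?A = "map_mat of_real M :: 'k mat" and ?G = "map_mat of_real (geometric_mean M \<epsilon>) :: 'k mat"
  fix i j assume "i < dim_row L" "j < dim_col L"
  then have ij: "i < n" "j < n" using L by auto
  have Mc: "M \<in> carrier_mat n n" using M by (simp add: stochastic_mat_def)
  note Gc = geometric_mean_carrier[OF Mc, of \<epsilon>]
  have A: "?A \<in> carrier_mat n n" and G: "?G \<in> carrier_mat n n" using Mc Gc by auto
  have ent: "of_real (geometric_mean M \<epsilon> $$ (i, l)) =
      of_real (1 - \<epsilon>) * (?G * ?A) $$ (i, l) + of_real \<epsilon> * (if l = i then 1 else 0 :: 'k)"
    if l: "l < n" for l
  proof -
    have "(geometric_mean M \<epsilon> - geometric_mean M \<epsilon> * M) $$ (i, l) =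
        (\<epsilon> \<cdot>\<^sub>m (1\<^sub>m n - geometric_mean M \<epsilon> * M)) $$ (i, l)"
      by (simp only: geometric_mean_defect[OF M e])
    then have "geometric_mean M \<epsilon> $$ (i, l) =
        (1 - \<epsilon>) * (geometric_mean M \<epsilon> * M) $$ (i, l) + \<epsilon> * (if l = i then 1 else 0)"
      using l ij Mc Gc by (auto simp: algebra_simps simp del: index_mult_mat(1))
    moreover have "(?G * ?A) $$ (i, l) = of_real ((geometric_mean M \<epsilon> * M) $$ (i, l))"
      using l ij Mc Gc
      by (simp add: of_real_hom.mat_hom_mult[OF Gc Mc, symmetric] del: index_mult_mat(1))
    ultimately show ?thesis by simp
  qed
  have "(?G * L) $$ (i, j) = (\<Sum>l<n. of_real (geometric_mean M \<epsilon> $$ (i, l)) * L $$ (l, j))"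
    using ij Gc by (subst index_mult_mat_sum[OF G L]) auto
  also have "\<dots> = (\<Sum>l<n. of_real (1 - \<epsilon>) * ((?G * ?A) $$ (i, l) * L $$ (l, j)) +
      (if l = i then of_real \<epsilon> * L $$ (l, j) else 0))"
    by (intro sum.cong) (auto simp: ent algebra_simps simp del: index_mult_mat(1))
  also have "\<dots> = of_real (1 - \<epsilon>) * (?G * ?A * L) $$ (i, j) + of_real \<epsilon> * L $$ (i, j)"
    using ij index_mult_mat_sum[OF mult_carrier_mat[OF G A] L]
    by (simp add: sum.distrib del: index_mult_mat(1) flip: sum_distrib_left)
  also have "?G * ?A * L = ?G * L" using assoc_mult_mat[OF G A L] fixL by simp
  finally have "of_real \<epsilon> * (?G * L) $$ (i, j) = of_real \<epsilon> * L $$ (i, j)"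
    by (simp add: algebra_simps del: index_mult_mat(1))
  then show "(?G * L) $$ (i, j) = L $$ (i, j)" using e by simp
qed (use geometric_mean_carrier[of M n \<epsilon>] M L in \<open>auto simp: stochastic_mat_def\<close>)

text \<open>Conjugation commutes with powers, and the powers of \<open>M\<close> have entries in the
  unit interval, which leaves a bound free of \<open>k\<close>.\<close>

lemma similar_stochastic_pow_bounded:
  fixes P Q :: "'k::real_normed_field mat"
  assumes M: "stochastic_mat n M" and P: "P \<in> carrier_mat n n" and Q: "Q \<in> carrier_mat n n"
    and PQ: "P * Q = 1\<^sub>m n" and QP: "Q * P = 1\<^sub>m n" and ij: "i < n" "j < n"
  shows "norm (((P * map_mat of_real M * Q) ^\<^sub>m k) $$ (i, j)) \<le>
    (\<Sum>q<n. \<Sum>p<n. norm (P $$ (i, p)) * norm (Q $$ (q, j)))"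
proof -
  let ?A = "map_mat of_real M :: 'k mat"
  have Mc: "M \<in> carrier_mat n n" using M by (simp add: stochastic_mat_def)
  then have A: "?A \<in> carrier_mat n n" by simp
  have pw: "norm ((?A ^\<^sub>m k) $$ (p, q)) \<le> 1" if "p < n" "q < n" for p q
    using that Mc stochastic_mat_entry[OF stochastic_mat_pow[OF M]]
    by (simp flip: of_real_hom.mat_hom_pow[OF Mc])
  have "similar_mat_wit (P * ?A * Q) ?A P Q"
    using P Q A PQ QP by (simp add: similar_mat_wit_def Let_def)
  then have "((P * ?A * Q) ^\<^sub>m k) $$ (i, j) = (P * ?A ^\<^sub>m k * Q) $$ (i, j)"
    by (simp only: similar_mat_wit_pow_id)
  also have "\<dots> = (\<Sum>q<n. (\<Sum>p<n. P $$ (i, p) * (?A ^\<^sub>m k) $$ (p, q)) * Q $$ (q, j))"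
    using ij P A Q
    by (simp add: index_mult_mat_sum[of _ n n _ n] pow_carrier_mat mult_carrier_mat[of _ n n]
        del: index_mult_mat(1))
  also have "norm \<dots> \<le> (\<Sum>q<n. \<Sum>p<n. norm (P $$ (i, p)) * norm (Q $$ (q, j)))"
    unfolding sum_distrib_right
    by (intro sum_norm_le) (auto simp: norm_mult intro!: mult_right_mono mult_left_le pw)
  finally show ?thesis .
qed

text \<open>The field \<open>'k\<close> may be the complex numbers, which hold the non-real
  eigenvalues, while the limit is a real matrix compared after embedding. Since
  \<open>row_map\<close> reverses products, the composition in the last conjunct has the matrix
  \<open>Q * P_fix_J * Q_inv\<close>.\<close>

theorem theoremV3:
  fixes n :: nat and M :: "real mat"
    and Q Q_inv J :: "'k::{real_normed_field, conjugatable_field} mat"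
    and n_as :: "(nat \<times> 'k) list"
  assumes "stochastic_mat n M"
    and "Q \<in> carrier_mat n n" and "Q_inv \<in> carrier_mat n n"
    and "Q * Q_inv = 1\<^sub>m n" and "Q_inv * Q = 1\<^sub>m n"
    and "J = Q_inv * map_mat of_real M * Q"
    and "jordan_nf (map_mat of_real M) n_as" and "J = jordan_matrix n_as"
  shows "\<exists>P_fix_M P_fix_J.
      mat_tendsto n (ergodic_mean M) P_fix_M sequentially \<and>
      mat_tendsto n (geometric_mean M) P_fix_M (at_right 0) \<and>
      projection_onto n P_fix_M (fix_space n M) \<and>
      projection_onto n P_fix_J (fix_space n J) \<and>
      orthogonal_projection n P_fix_J \<and>
      (\<forall>v\<in>carrier_vec n. row_map (map_mat of_real P_fix_M) v =
         (row_map Q_inv \<circ> row_map P_fix_J \<circ> row_map Q) v)"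
proof -
  let ?A = "map_mat of_real M :: 'k mat"
  note M = assms(1) and Q = assms(2) and R = assms(3) and QR = assms(4) and RQ = assms(5)
  have Mc: "M \<in> carrier_mat n n" using M by (simp add: stochastic_mat_def)
  then have A: "?A \<in> carrier_mat n n" by simp
  have J: "J \<in> carrier_mat n n" using Q R A assms(6) by simp
  define D where
    "D = mat n n (\<lambda>(i, j). if i = j \<and> jordan_matrix n_as $$ (i, i) = 1 then 1 else 0 :: 'k)"
  have D: "D \<in> carrier_mat n n" by (simp add: D_def)
  have bdd: "norm ((jordan_matrix n_as ^\<^sub>m k) $$ (i, j)) \<le>
      (\<Sum>q<n. \<Sum>p<n. norm (Q_inv $$ (i, p)) * norm (Q $$ (q, j)))" if "i < n" "j < n" for k i j
    using similar_stochastic_pow_bounded[OF M R Q RQ QR that, of k] assms(6,8) by simp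
  note proj = jordan_matrix_fix_projection[OF J[unfolded assms(8)] bdd, folded D_def assms(8)]
  have JD: "J * D = D" and DJ: "D * J = D" using proj(1,2) by blast+
  obtain V where V: "V \<in> carrier_mat n n" and JV: "(1\<^sub>m n - J) * V = 1\<^sub>m n - D"
    using proj(3) by blast
  \<comment> \<open>\<open>L\<close> and \<open>Z\<close> carry \<open>D\<close> and
    \<open>V\<close> back to the original basis, so that \<open>AL\<close>, \<open>LA\<close> and
    \<open>AZ\<close> below are the conjugates of \<open>JD\<close>, \<open>DJ\<close> and
    \<open>JV\<close>.\<close>
  define L where "L = Q * D * Q_inv"
  define Z where "Z = Q * V * Q_inv"
  have L: "L \<in> carrier_mat n n" and Z: "Z \<in> carrier_mat n n"
    using Q R D V by (auto simp: L_def Z_def)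
  have QJ: "Q * J = ?A * Q"
  proof -
    have "Q * J = Q * (Q_inv * (?A * Q))"
      unfolding assms(6) using Q R A by simp
    also have "\<dots> = Q * Q_inv * (?A * Q)" using Q R A by (intro assoc_mult_mat[symmetric]) auto
    finally show ?thesis using Q A by (simp add: QR)
  qed
  have JR: "J * Q_inv = Q_inv * ?A"
  proof -
    have "J * Q_inv = Q_inv * ?A * (Q * Q_inv)"
      unfolding assms(6) using Q R A by (intro assoc_mult_mat) auto
    then show ?thesis using R A by (simp add: QR)
  qed
  have conj: "?A * (Q * X * Q_inv) = Q * (J * X) * Q_inv" if X: "X \<in> carrier_mat n n" for X
  proof -
    have "?A * (Q * X * Q_inv) = ?A * Q * X * Q_inv"
      using A Q R X by (simp add: assoc_mult_mat[of _ n n _ n _ n])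
    also have "\<dots> = Q * J * X * Q_inv" by (simp only: QJ)
    finally show ?thesis using J Q R X by (simp add: assoc_mult_mat[of _ n n _ n _ n])
  qed
  have AL: "?A * L = L" unfolding L_def conj[OF D] JD ..
  have LA: "L * ?A = L"
  proof -
    have "L * ?A = Q * D * (Q_inv * ?A)" unfolding L_def
      using A Q R D by (simp add: assoc_mult_mat[of _ n n _ n _ n])
    also have "\<dots> = Q * (D * J) * Q_inv"
      unfolding JR[symmetric] using J Q R D by (simp add: assoc_mult_mat[of _ n n _ n _ n])
    finally show ?thesis unfolding DJ L_def .
  qed
  have AZ: "(1\<^sub>m n - ?A) * Z = 1\<^sub>m n - L"
  proof -
    have "(1\<^sub>m n - ?A) * Z = Z - ?A * Z"
      using A Z by (subst minus_mult_distrib_mat) auto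
    also have "\<dots> = Q * V * Q_inv - Q * (J * V) * Q_inv"
      unfolding Z_def conj[OF V] ..
    also have "\<dots> = (Q * V - Q * (J * V)) * Q_inv"
      using Q R J V by (intro minus_mult_distrib_mat[symmetric]) auto
    also have "Q * V - Q * (J * V) = Q * (V - J * V)"
      using Q J V by (intro mult_minus_distrib_mat[symmetric]) auto
    also have "V - J * V = (1\<^sub>m n - J) * V"
      using J V by (subst minus_mult_distrib_mat) auto
    also have "Q * ((1\<^sub>m n - J) * V) = Q - Q * D"
      unfolding JV using Q D by (subst mult_minus_distrib_mat) auto
    also have "\<dots> * Q_inv = Q * Q_inv - Q * D * Q_inv"
      using Q R D by (intro minus_mult_distrib_mat) auto
    finally show ?thesis by (simp add: QR L_def)
  qed
  have S: "((\<lambda>N. of_real (ergodic_mean M N $$ (i, j))) \<longlongrightarrow> L $$ (i, j)) sequentially"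
    if ij: "i < n" "j < n" for i j
  proof (rule mean_tendsto_fix_projection[OF Mc L Z AZ _ _ ij])
    show "\<forall>\<^sub>F N in sequentially. ergodic_mean M N \<in> carrier_mat n n \<and> stochastic_mat n (M ^\<^sub>m N) \<and>
        ergodic_mean M N - ergodic_mean M N * M = (1 / real N) \<cdot>\<^sub>m (1\<^sub>m n - M ^\<^sub>m N) \<and>
        map_mat of_real (ergodic_mean M N) * L = L"
      \<comment> \<open>This discards \<open>N = 0\<close>, where the mean need not fix
        \<open>L\<close>.\<close>
      using eventually_gt_at_top[of 0]
    proof eventually_elim
      case (elim N)
      then show ?case
        using Mc stochastic_mat_pow[OF M] ergodic_mean_defect[OF Mc]
          ergodic_mean_mult_fixed[OF Mc L AL] ergodic_mean_carrier[OF Mc] by blast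
    qed
    show "(\<lambda>N. 1 / real N) \<longlonglongrightarrow> 0" by (rule lim_1_over_n)
  qed
  have C: "((\<lambda>\<epsilon>. of_real (geometric_mean M \<epsilon> $$ (i, j))) \<longlongrightarrow> L $$ (i, j)) (at_right 0)"
    if ij: "i < n" "j < n" for i j
  proof (rule mean_tendsto_fix_projection[OF Mc L Z AZ _ _ ij])
    show "\<forall>\<^sub>F \<epsilon> in at_right 0. geometric_mean M \<epsilon> \<in> carrier_mat n n \<and>
        stochastic_mat n (geometric_mean M \<epsilon> * M) \<and>
        geometric_mean M \<epsilon> - geometric_mean M \<epsilon> * M =
          \<epsilon> \<cdot>\<^sub>m (1\<^sub>m n - geometric_mean M \<epsilon> * M) \<and>
        map_mat of_real (geometric_mean M \<epsilon>) * L = L"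
      using eventually_at_right_real[of 0 1, simplified]
    proof eventually_elim
      case (elim \<epsilon>)
      then show ?case
        using geometric_mean_carrier[OF Mc] stochastic_mat_mult[OF stochastic_geometric_mean[OF M] M]
          geometric_mean_defect[OF M] geometric_mean_mult_fixed[OF M _ _ L AL] by simp
    qed
    show "((\<lambda>\<epsilon>. \<epsilon>) \<longlongrightarrow> 0) (at_right (0::real))" by (rule tendsto_ident_at)
  qed
  have "\<exists>r. L $$ (i, j) = of_real r" if "i < n" "j < n" for i j
    using LIMSEQ_of_real_imp_real_limit[OF S[OF that]] by blast
  then obtain r where r: "\<And>i j. i < n \<Longrightarrow> j < n \<Longrightarrow> L $$ (i, j) = of_real (r i j)" by metis
  \<comment> \<open>The real witness for \<open>P_fix_M\<close>: its image under
    \<open>of_real\<close> is \<open>L\<close>.\<close>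
  define P where "P = mat n n (\<lambda>(i, j). r i j)"
  have P: "P \<in> carrier_mat n n" by (simp add: P_def)
  have LP: "L = map_mat of_real P"
    using L r by (intro eq_matI) (auto simp: P_def)
  have lim: "mat_tendsto n (ergodic_mean M) P sequentially" "mat_tendsto n (geometric_mean M) P (at_right 0)"
    using S C P ergodic_mean_carrier[OF Mc] geometric_mean_carrier[OF Mc]
    by (auto simp: mat_tendsto_def LP tendsto_of_real_iff)
  have "map_mat of_real (P * M) = (map_mat of_real P :: 'k mat)"
    using LA unfolding LP by (simp add: of_real_hom.mat_hom_mult[OF P Mc])
  then have PM: "P * M = P" by (rule of_real_hom.mat_hom_inj)
  have "projection_onto n P (fix_space n M)"
  proof (rule projection_onto_fix_space[OF Mc P PM])
    fix v assume v: "v \<in> fix_space n M"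
    then have vc: "v \<in> carrier_vec n" by (simp add: fix_space_def)
    \<comment> \<open>The matrix \<open>Z\<close> has entries in \<open>'k\<close>, so the real
      fixed vector is embedded, treated there, and recovered by injectivity.\<close>
    let ?v = "map_vec of_real v :: 'k vec"
    have hom: "row_map (map_mat of_real B) ?v = map_vec of_real (row_map B v)"
      if "B \<in> carrier_mat n n" for B
      using that vc by (simp add: row_map_def map_mat_transpose of_real_hom.mult_mat_vec_hom[of _ n n])
    have "?v \<in> fix_space n ?A"
      using v vc hom[OF Mc] by (simp add: fix_space_def)
    then have "row_map L ?v = ?v" by (rule row_map_fix_space[OF A L Z AZ])
    then have "map_vec of_real (row_map P v) = ?v" unfolding LP hom[OF P] .
    then show "row_map P v = v" by (rule of_real_hom.vec_hom_inj)
  qed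
  moreover have DP: "projection_onto n D (fix_space n J)"
    by (rule projection_onto_fix_space[OF J D DJ row_map_fix_space[OF J D V JV]])
  moreover have "orthogonal_projection n D"
    using DP by (intro orthogonal_projection_diagonal) (auto simp: projection_onto_def D_def)
  moreover have "row_map (map_mat of_real P) v = (row_map Q_inv \<circ> row_map D \<circ> row_map Q) v"
    if "v \<in> carrier_vec n" for v :: "'k vec"
    using that Q R D
    by (simp add: LP[symmetric] L_def row_map_def transpose_mult[of _ n n _ n]
        assoc_mult_mat_vec[of _ n n _ n])
  ultimately show ?thesis using lim by blast
qed

end
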